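(* Assume $\Delta\neq 0$ and $\dfrac{a^2}{b}\notin\mathbb{F}_q$. For every integer $i\ge 1$, we have: (a) if $\Delta\equiv 0\pmod P$, then $e_i=\dfrac{(p^i-1)e_1}{p-1}$, and $\alpha(P^{e_i})=p^i$; (b) if $\Delta\not\equiv 0\pmod P$, then $e_i=p^{i-1}e_1$, and $\alpha(P^{e_i})=p^{i-1}\alpha(P)$.
   Context: Let $\mathbb{F}_q$ be the finite field with $q=p^l$ elements, $p$ prime, $l\ge1$. Fix $a,b\in\mathbb{F}_q[x]$ with $b\neq 0$, and put $\Delta=a^2+4b$. The generalized Fibonacci sequence is $F_0=0$, $F_1=1$, $F_n=aF_{n-1}+bF_{n-2}$ for $n\ge 2$. Fix an irreducible polynomial $P\in\mathbb{F}_q[x]$ with $\gcd(b,P)=1$. For a non-constant $M\in\mathbb{F}_q[x]$ with $\gcd(b,M)=1$, the rank $\alpha(M)$ is the least positive integer $n$ with $F_n\equiv 0\pmod M$. For $i\ge 1$, $e_i$ denotes the $i$-th smallest positive integer $e$ such that $\alpha(P^e)\neq\alpha(P^{e+1})$ (under the hypotheses of the claim, all $e_i$ exist). *)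

theory Defs
  imports
    Complex_Main
    "HOL-Computational_Algebra.Computational_Algebra"
    "HOL-Library.Cardinality"
    "HOL-Library.Infinite_Set"
begin

fun gen_fib :: "'a::comm_ring_1 poly \<Rightarrow> 'a poly \<Rightarrow> nat \<Rightarrow> 'a poly" where
  "gen_fib a b 0 = 0"
| "gen_fib a b (Suc 0) = 1"
| "gen_fib a b (Suc (Suc n)) = a * gen_fib a b (Suc n) + b * gen_fib a b n"

definition fib_discr :: "'a::comm_ring_1 poly \<Rightarrow> 'a poly \<Rightarrow> 'a poly" where
  "fib_discr a b = a ^ 2 + 4 * b"

text \<open>
  Over a finite field, such an \<open>n\<close> exists for every \<open>M \<noteq> 0\<close> that is coprime to \<open>b\<close>
  (the sequence modulo \<open>M\<close> is then purely periodic); otherwise the value may be meaningless.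
\<close>

definition fib_rank :: "'a::comm_ring_1 poly \<Rightarrow> 'a poly \<Rightarrow> 'a poly \<Rightarrow> nat" where
  "fib_rank a b M = (LEAST n. 0 < n \<and> M dvd gen_fib a b n)"

definition rank_jumps :: "'a::comm_ring_1 poly \<Rightarrow> 'a poly \<Rightarrow> 'a poly \<Rightarrow> nat set" where
  "rank_jumps a b P = {e. 0 < e \<and> fib_rank a b (P ^ e) \<noteq> fib_rank a b (P ^ (e + 1))}"

text \<open>
  The \<open>i\<close>-th smallest rank jump, counted from \<open>i = 1\<close>, whereas \<^term>\<open>enumerate\<close> counts
  from \<open>0\<close>. Only meaningful for \<open>i \<ge> 1\<close> and if there are at least \<open>i\<close> jumps.
\<close>

definition rank_jump :: "'a::comm_ring_1 poly \<Rightarrow> 'a poly \<Rightarrow> 'a poly \<Rightarrow> nat \<Rightarrow> nat" where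
  "rank_jump a b P i = enumerate (rank_jumps a b P) (i - 1)"

text \<open>Membership of the quotient of two polynomials, as a rational function, in the constant field.\<close>

definition const_quot :: "'a::field poly \<Rightarrow> 'a poly \<Rightarrow> bool" where
  "const_quot f g \<longleftrightarrow> Fract f g \<in> range (\<lambda>c. Fract [:c:] 1)"

end

theory Submission
  imports Defs
begin

text \<open>
  Write \<open>F n\<close> for the sequence, \<open>\<Delta>\<close> for the discriminant and \<open>v\<close> for the \<open>P\<close>-adic valuation.
  Everything comes from knowing \<open>v (F n)\<close> for every \<open>n\<close> with \<open>P dvd F n\<close>, that is, for
  the multiples of the rank \<open>r\<close> of \<open>P\<close> (\<open>fib_rank_prime\<close>).

  Passing from \<open>n\<close> to \<open>m * n\<close> with \<open>p\<close> not dividing \<open>m\<close> does not change the valuation, because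
  \<open>F (m * n)\<close> is \<open>m * F (n + 1) ^ (m - 1) * F n\<close> modulo \<open>F n ^ 2\<close>, and the cofactor of \<open>F n\<close> is
  prime to \<open>P\<close> (\<open>exact_power_gen_fib_mult\<close>). Passing from \<open>n\<close> to \<open>p * n\<close> is governed by Frobenius:
  in \<open>R[X] / (X^2 - a X - b)\<close> one has \<open>X ^ n = F n * X + b * F (n - 1)\<close>, and raising this to the
  \<open>p\<close>-th power gives the exact identity \<open>F (p * n) = F p * F n ^ p\<close> (\<open>gen_fib_mult_char\<close>).
  Hence \<open>v (F (r * p ^ k * m)) = s k\<close> for \<open>m\<close> prime to \<open>p\<close>, where
  \<open>s (k + 1) = v (F p) + p * s k\<close>.

  The sequence \<open>s\<close> is strictly increasing, so the rank of \<open>P ^ e\<close> is \<open>r * p ^ k\<close> for the least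
  \<open>k\<close> with \<open>e \<le> s k\<close>, and it jumps exactly at the values of \<open>s\<close> (\<open>rank_jumps_eqI\<close>).
  Finally \<open>F p ^ 2 = \<Delta> ^ (p - 1)\<close> (\<open>gen_fib_char_squared\<close>) separates the two cases. If \<open>P\<close>
  does not divide \<open>\<Delta>\<close>, then \<open>v (F p) = 0\<close> and \<open>s\<close> is geometric. If \<open>P dvd \<Delta>\<close>, then \<open>P dvd F p\<close>,
  so \<open>r = p\<close> and \<open>s 0 = v (F p)\<close>, which makes \<open>s\<close> a partial sum of a geometric series.

  The valuations are finite only if no \<open>F n\<close> with \<open>n > 0\<close> vanishes, and this is what the hypotheses
  on \<open>\<Delta>\<close> and on \<open>a^2 / b\<close> are for (\<open>gen_fib_nonzero\<close>): in terms of the roots of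
  \<open>X^2 - a X - b\<close>, a zero would make their quotient a root of unity, hence \<open>a^2 / b\<close> algebraic over
  the constants, hence constant.
\<close>

section \<open>Exact prime power divisors\<close>

text \<open>
  This says that \<open>x\<close> has \<open>P\<close>-adic valuation \<open>s\<close>. It is a relation instead of a function so that
  \<open>x = 0\<close>, for \<open>P \<noteq> 0\<close>, has no valuation at all rather than a default one.
\<close>

definition exact_power :: "'r::idom \<Rightarrow> nat \<Rightarrow> 'r \<Rightarrow> bool" where
  "exact_power P s x \<longleftrightarrow> (\<exists>y. x = P ^ s * y \<and> \<not> P dvd y)"

lemma exact_power_dvd_iff:
  fixes P x :: "'r::idom"
  assumes "P \<noteq> 0" and "exact_power P s x"
  shows "P ^ e dvd x \<longleftrightarrow> e \<le> s"
proof
  obtain y where y: "x = P ^ s * y" "\<not> P dvd y"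
    using assms(2) unfolding exact_power_def by blast
  show "P ^ e dvd x" if "e \<le> s"
    using that y(1) by (simp add: le_imp_power_dvd dvd_mult2)
  show "e \<le> s" if dvd: "P ^ e dvd x"
  proof (rule ccontr)
    assume "\<not> e \<le> s"
    then have "P ^ Suc s dvd P ^ e" by (intro le_imp_power_dvd) simp
    then have "P ^ s * P dvd P ^ s * y"
      using dvd y(1) dvd_trans by (metis power_Suc2)
    then show False using assms(1) y(2) by simp
  qed
qed

lemma exact_power_mult:
  fixes P :: "'r::idom"
  assumes "prime_elem P" and "exact_power P s x" and "exact_power P t y"
  shows "exact_power P (s + t) (x * y)"
proof -
  obtain x' y' where "x = P ^ s * x'" "\<not> P dvd x'" "y = P ^ t * y'" "\<not> P dvd y'"
    using assms(2,3) unfolding exact_power_def by blast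
  then have "x * y = P ^ (s + t) * (x' * y')" "\<not> P dvd x' * y'"
    using assms(1) by (auto simp: power_add algebra_simps prime_elem_dvd_mult_iff)
  then show ?thesis unfolding exact_power_def by blast
qed

lemma exact_power_0_iff: "exact_power P 0 x \<longleftrightarrow> \<not> P dvd x"
  by (simp add: exact_power_def)

lemma exact_power_power:
  fixes P :: "'r::idom"
  assumes "prime_elem P" and "exact_power P s x"
  shows "exact_power P (n * s) (x ^ n)"
proof (induction n)
  case 0
  then show ?case
    using assms(1) by (auto simp: exact_power_0_iff prime_elem_def)
next
  case (Suc n)
  then show ?case using exact_power_mult[OF assms Suc] by (simp add: add.commute)
qed

lemma exact_power_exists:
  fixes P x :: "'a::field poly"
  assumes "degree P > 0" and "x \<noteq> 0"
  shows "\<exists>s. exact_power P s x"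
  using assms(2)
proof (induction "degree x" arbitrary: x rule: less_induct)
  case less
  show ?case
  proof (cases "P dvd x")
    case False
    then show ?thesis by (auto simp flip: exact_power_0_iff)
  next
    case True
    then obtain y where y: "x = P * y" by blast
    with less.prems have "y \<noteq> 0" "P \<noteq> 0" by auto
    then have "degree y < degree x" using y assms(1) by (simp add: degree_mult_eq)
    then obtain s z where "y = P ^ s * z" "\<not> P dvd z"
      using less.hyps \<open>y \<noteq> 0\<close> unfolding exact_power_def by blast
    then have "x = P ^ Suc s * z" "\<not> P dvd z" using y by (simp_all add: algebra_simps)
    then show ?thesis unfolding exact_power_def by blast
  qed
qed

section \<open>Identities for the generalized Fibonacci sequence\<close>

lemma gen_fib_add_Suc:
  "gen_fib a b (Suc (m + n)) =
     gen_fib a b (Suc m) * gen_fib a b (Suc n) + b * gen_fib a b m * gen_fib a b n"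
proof (induction a b m rule: gen_fib.induct)
  case (3 a b m)
  have "gen_fib a b (Suc (Suc (Suc m) + n))
      = a * gen_fib a b (Suc (Suc m + n)) + b * gen_fib a b (Suc (m + n))"
    by simp
  then show ?case
    by (simp only: 3 gen_fib.simps) (simp add: algebra_simps)
qed auto

text \<open>
  A form of the addition formula without the index \<open>n - 1\<close>, symmetric in \<open>m\<close> and \<open>n\<close>; modulo
  \<open>F m\<close> only the first summand remains.
\<close>

lemma gen_fib_add:
  "gen_fib a b (m + n) =
     gen_fib a b (Suc m) * gen_fib a b n + gen_fib a b m * gen_fib a b (Suc n)
     - a * gen_fib a b m * gen_fib a b n"
  by (cases n) (simp_all add: gen_fib_add_Suc algebra_simps)

text \<open>
  A generalization of d'Ocagne's identity. Reading it modulo \<open>P\<close> shows that consecutive terms are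
  not both divisible by \<open>P\<close>, and that a repeated pair of residues forces a zero modulo \<open>P\<close>.
\<close>

lemma gen_fib_docagne:
  "gen_fib a b (Suc i) * gen_fib a b (i + k) - gen_fib a b i * gen_fib a b (Suc (i + k))
     = (- b) ^ i * gen_fib a b k"
  by (induction i) (simp_all add: algebra_simps)

lemma gen_fib_Suc_mult_mod:
  "gen_fib a b n dvd gen_fib a b (Suc (m * n)) - gen_fib a b (Suc n) ^ m"
proof (induction m)
  case (Suc m)
  then obtain t where t: "gen_fib a b (Suc (m * n)) = gen_fib a b (Suc n) ^ m + gen_fib a b n * t"
    by (metis diff_add_cancel dvdE add.commute)
  show ?case
    using gen_fib_add_Suc[of a b "m * n" n]
    by (intro dvdI[of _ _ "gen_fib a b (Suc n) * t + b * gen_fib a b (m * n)"])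
       (simp add: t algebra_simps)
qed simp

lemma gen_fib_mult_mod:
  "gen_fib a b n ^ 2 dvd
     gen_fib a b (m * n) - of_nat m * gen_fib a b (Suc n) ^ (m - 1) * gen_fib a b n"
proof (induction m)
  case (Suc m)
  define x y where "x = gen_fib a b n" and "y = gen_fib a b (Suc n)"
  obtain s where s: "gen_fib a b (m * n) = of_nat m * y ^ (m - 1) * x + x ^ 2 * s"
    using Suc unfolding x_def y_def by (metis diff_add_cancel dvdE add.commute)
  obtain t where t: "gen_fib a b (Suc (m * n)) = y ^ m + x * t"
    using gen_fib_Suc_mult_mod[of a b n m] unfolding x_def y_def
    by (metis diff_add_cancel dvdE add.commute)
  have y: "of_nat m * y ^ (m - 1) * y = of_nat m * y ^ m"
    by (cases m) (simp_all add: algebra_simps)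
  have "gen_fib a b (Suc m * n) = gen_fib a b (m * n + n)" by (simp add: add.commute)
  also have "\<dots> = (y ^ m + x * t) * x + (of_nat m * y ^ (m - 1) * x + x ^ 2 * s) * y
      - a * (of_nat m * y ^ (m - 1) * x + x ^ 2 * s) * x"
    using gen_fib_add[of a b "m * n" n] by (simp add: s t flip: x_def y_def)
  also have "\<dots> = y ^ m * x + (of_nat m * y ^ (m - 1) * y) * x
      + x ^ 2 * (t + s * y - a * (of_nat m * y ^ (m - 1) + x * s))"
    by (simp add: algebra_simps power2_eq_square)
  also have "\<dots> = of_nat (Suc m) * y ^ m * x
      + x ^ 2 * (t + s * y - a * (of_nat m * y ^ (m - 1) + x * s))"
    unfolding y by (simp add: algebra_simps)
  finally show ?case by (simp flip: x_def y_def)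
qed simp

section \<open>Frobenius modulo the characteristic polynomial\<close>

definition fib_charpoly :: "'a::comm_ring_1 poly \<Rightarrow> 'a poly \<Rightarrow> 'a poly poly" where
  "fib_charpoly a b = [:- b, - a, 1:]"

text \<open>
  The characteristic polynomial is monic of degree 2, so coefficients of linear remainders can be
  compared; all identities of this section are obtained in this way.
\<close>

lemma fib_charpoly_dvd_linear_iff:
  fixes a b c d :: "'a::idom poly"
  shows "fib_charpoly a b dvd [:d, c:] \<longleftrightarrow> c = 0 \<and> d = 0"
proof
  assume *: "fib_charpoly a b dvd [:d, c:]"
  have "degree (fib_charpoly a b) = 2" by (simp add: fib_charpoly_def)
  moreover have "degree [:d, c:] \<le> 1" by simp
  ultimately have "[:d, c:] = 0" using dvd_imp_degree_le[OF *] by fastforce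
  then show "c = 0 \<and> d = 0" by simp
qed simp

text \<open>
  Every root \<open>z\<close> of the characteristic polynomial in the quotient ring satisfies
  \<open>z ^ n = F n * z + b * F (n - 1)\<close>. It is needed for \<open>z = X\<close> and for the conjugate root
  \<open>z = a - X\<close>.
\<close>

lemma root_power_gen_fib:
  assumes "fib_charpoly a b dvd z ^ 2 - ([:a:] * z + [:b:])"
  shows "fib_charpoly a b dvd
    z ^ Suc n - ([:gen_fib a b (Suc n):] * z + [:b * gen_fib a b n:])"
proof (induction n)
  case 0
  then show ?case by (simp add: one_pCons[symmetric])
next
  case (Suc n)
  have "z ^ Suc (Suc n) - ([:gen_fib a b (Suc (Suc n)):] * z + [:b * gen_fib a b (Suc n):])
    = z * (z ^ Suc n - ([:gen_fib a b (Suc n):] * z + [:b * gen_fib a b n:]))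
      + [:gen_fib a b (Suc n):] * (z ^ 2 - ([:a:] * z + [:b:]))"
    by (simp add: algebra_simps power2_eq_square smult_add_left smult_add_right)
  then show ?case using Suc assms by (simp only: dvd_add dvd_mult)
qed

lemma fib_charpoly_X: "fib_charpoly a b dvd [:0, 1:] ^ 2 - ([:a:] * [:0, 1:] + [:b:])"
  by (simp add: fib_charpoly_def power2_eq_square)

lemma fib_charpoly_conj: "fib_charpoly a b dvd [:a, -1:] ^ 2 - ([:a:] * [:a, -1:] + [:b:])"
  by (simp add: fib_charpoly_def power2_eq_square)

lemma diff_dvd_power_diff:
  fixes x y :: "'r::comm_ring_1"
  shows "x - y dvd x ^ n - y ^ n"
  by (simp add: power_diff_sumr2)

text \<open>
  Frobenius turns \<open>X ^ n = F n * X + b * F (n - 1)\<close> into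
  \<open>X ^ (p * n) = F n ^ p * X ^ p + (b * F (n - 1)) ^ p\<close>. Expanding \<open>X ^ p\<close> and \<open>X ^ (p * n)\<close> as well
  and comparing the coefficients of \<open>X\<close> gives the identity.
\<close>

lemma gen_fib_mult_char:
  fixes a b :: "'a::{idom_prime_char} poly"
  defines "p \<equiv> CHAR('a)"
  shows "gen_fib a b (p * n) = gen_fib a b p * gen_fib a b n ^ p"
proof (cases n)
  case 0
  then show ?thesis by (simp add: p_def zero_power)
next
  case (Suc m)
  define X :: "'a poly poly" where "X = [:0, 1:]"
  let ?F = "gen_fib a b"
  have p: "p = CHAR('a poly poly)" "prime CHAR('a poly poly)" "p > 0"
    unfolding p_def by simp_all
  obtain q where q: "p = Suc q" using p(3) gr0_implies_Suc by blast
  obtain r where r: "p * n = Suc r" using p(3) Suc gr0_implies_Suc by force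
  note root = root_power_gen_fib[OF fib_charpoly_X[of a b], folded X_def]
  have 1: "fib_charpoly a b dvd X ^ (p * n) - ([:?F (p * n):] * X + [:b * ?F r:])"
    using root[of r] r by simp
  have 2: "fib_charpoly a b dvd
      X ^ (p * n) - ([:?F n ^ p:] * X ^ p + [:(b * ?F m) ^ p:])"
  proof -
    have "X ^ n - ([:?F n:] * X + [:b * ?F m:]) dvd
        (X ^ n) ^ p - ([:?F n:] * X + [:b * ?F m:]) ^ p"
      by (rule diff_dvd_power_diff)
    also have "([:?F n:] * X + [:b * ?F m:]) ^ p = [:?F n ^ p:] * X ^ p + [:(b * ?F m) ^ p:]"
      by (simp only: freshmans_dream[OF p(2,1)] power_mult_distrib poly_const_pow)
    finally have "X ^ n - ([:?F n:] * X + [:b * ?F m:]) dvd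
        X ^ (p * n) - ([:?F n ^ p:] * X ^ p + [:(b * ?F m) ^ p:])"
      by (simp only: mult.commute[of p] power_mult)
    then show ?thesis
      using root[of m] unfolding Suc by (rule dvd_trans[rotated])
  qed
  have 3: "fib_charpoly a b dvd [:?F n ^ p:] * (X ^ p - ([:?F p:] * X + [:b * ?F q:]))"
    using root[of q] q by (intro dvd_mult) simp
  have "fib_charpoly a b dvd
      (X ^ (p * n) - ([:?F n ^ p:] * X ^ p + [:(b * ?F m) ^ p:]))
      + [:?F n ^ p:] * (X ^ p - ([:?F p:] * X + [:b * ?F q:]))
      - (X ^ (p * n) - ([:?F (p * n):] * X + [:b * ?F r:]))"
    by (rule dvd_diff[OF dvd_add[OF 2 3] 1])
  also have "\<dots> = [:b * ?F r - (b * ?F m) ^ p - ?F n ^ p * (b * ?F q),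
      ?F (p * n) - ?F n ^ p * ?F p:]"
    by (simp add: X_def algebra_simps)
  finally show ?thesis by (simp add: fib_charpoly_dvd_linear_iff mult.commute)
qed

text \<open>
  The difference \<open>W = X - Y\<close> of the two roots satisfies \<open>W ^ 2 = \<Delta>\<close>, and by Frobenius
  \<open>W ^ p = X ^ p - Y ^ p = F p * W\<close>. Squaring the latter yields \<open>\<Delta> ^ p = F p ^ 2 * \<Delta>\<close>. Squaring
  avoids the exponent \<open>(p - 1) / 2\<close>, and with it a separate treatment of \<open>p = 2\<close>.
\<close>

lemma gen_fib_char_squared:
  fixes a b :: "'a::{idom_prime_char} poly"
  defines "p \<equiv> CHAR('a)"
  assumes "fib_discr a b \<noteq> 0"
  shows "gen_fib a b p ^ 2 = fib_discr a b ^ (p - 1)"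
proof -
  define X Y :: "'a poly poly" where "X = [:0, 1:]" and "Y = [:a, -1:]"
  let ?F = "gen_fib a b" and ?D = "fib_discr a b"
  have p: "p = CHAR('a poly poly)" "prime CHAR('a poly poly)" "p > 0"
    unfolding p_def by simp_all
  obtain q where q: "p = Suc q" using p(3) gr0_implies_Suc by blast
  have "fib_charpoly a b dvd (X ^ p - ([:?F p:] * X + [:b * ?F q:]))
      - (Y ^ p - ([:?F p:] * Y + [:b * ?F q:]))"
    using root_power_gen_fib[OF fib_charpoly_X, of a b q]
      root_power_gen_fib[OF fib_charpoly_conj, of a b q]
    unfolding X_def Y_def q by (rule dvd_diff)
  also have "\<dots> = (X ^ p - Y ^ p) - [:?F p:] * (X - Y)"
    by (simp add: algebra_simps smult_diff_right)
  also have "X ^ p - Y ^ p = (X - Y) ^ p"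
    using freshmans_dream[OF p(2,1), of "X - Y" Y] by simp
  finally have "fib_charpoly a b dvd (X - Y) ^ p - [:?F p:] * (X - Y)" .
  also have "\<dots> dvd ((X - Y) ^ p) ^ 2 - ([:?F p:] * (X - Y)) ^ 2"
    by (rule diff_dvd_power_diff)
  also have "\<dots> = ((X - Y) ^ 2) ^ p - [:?F p ^ 2:] * (X - Y) ^ 2"
    by (simp only: power_mult_distrib poly_const_pow flip: power_mult) (simp add: mult.commute)
  finally have 1: "fib_charpoly a b dvd ((X - Y) ^ 2) ^ p - [:?F p ^ 2:] * (X - Y) ^ 2" .
  have "(X - Y) ^ 2 - [:?D:] = [:4:] * fib_charpoly a b"
    by (simp add: X_def Y_def fib_discr_def fib_charpoly_def power2_eq_square algebra_simps)
  then have 2: "fib_charpoly a b dvd (X - Y) ^ 2 - [:?D:]"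
    by (metis dvd_triv_right)
  have 3: "fib_charpoly a b dvd ((X - Y) ^ 2) ^ p - [:?D:] ^ p"
    using 2 diff_dvd_power_diff dvd_trans by blast
  have 4: "fib_charpoly a b dvd [:?F p ^ 2:] * ((X - Y) ^ 2 - [:?D:])"
    using 2 by (rule dvd_mult)
  have "fib_charpoly a b dvd (((X - Y) ^ 2) ^ p - [:?F p ^ 2:] * (X - Y) ^ 2)
      - (((X - Y) ^ 2) ^ p - [:?D:] ^ p) + [:?F p ^ 2:] * ((X - Y) ^ 2 - [:?D:])"
    by (intro dvd_add dvd_diff 1 3 4)
  also have "\<dots> = [:?D ^ p - ?F p ^ 2 * ?D, 0:]"
    by (simp add: algebra_simps poly_const_pow)
  finally have "?D ^ p = ?F p ^ 2 * ?D" by (simp only: fib_charpoly_dvd_linear_iff) simp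
  then have "?D ^ (p - 1) * ?D = ?F p ^ 2 * ?D" using q by simp
  then show ?thesis using assms(2) by simp
qed


section \<open>Nonvanishing\<close>

text \<open>
  A nonzero element \<open>d\<close> of least degree in the ideal generated by \<open>f\<close> and \<open>g\<close> divides both; the
  quotients then represent the fraction \<open>f / g\<close> in lowest terms.
\<close>

lemma poly_bezout_cofactors:
  fixes f g :: "'a::field poly"
  assumes "f \<noteq> 0"
  shows "\<exists>d u w x y. f = d * u \<and> g = d * w \<and> x * u + y * w = 1"
proof -
  define I where "I = {h. \<exists>x y. h = x * f + y * g}"
  have "f = 1 * f + 0 * g" by simp
  then have "f \<in> I" unfolding I_def by blast
  then obtain d where d: "d \<in> I" "d \<noteq> 0"
    and min: "\<And>h. h \<in> I \<Longrightarrow> h \<noteq> 0 \<Longrightarrow> degree d \<le> degree h"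
    using assms ex_has_least_nat[of "\<lambda>h. h \<in> I \<and> h \<noteq> 0" f degree] by blast
  obtain x y where xy: "d = x * f + y * g" using d(1) unfolding I_def by blast
  have dvd: "d dvd h" if h: "h = x' * f + y' * g" for h x' y'
  proof -
    have "h mod d = h - h div d * d" by (simp add: minus_div_mult_eq_mod)
    also have "\<dots> = (x' - h div d * x) * f + (y' - h div d * y) * g"
      using h xy by (simp add: algebra_simps)
    finally have "h mod d \<in> I" unfolding I_def by blast
    then have "h mod d = 0"
      using min[of "h mod d"] degree_mod_less'[OF d(2), of h] by fastforce
    then show ?thesis by (simp add: mod_eq_0_iff_dvd)
  qed
  have "d dvd f" "d dvd g" using dvd[of f 1 0] dvd[of g 0 1] by simp_all
  then obtain u w where uw: "f = d * u" "g = d * w" by (blast elim: dvdE)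
  have "d * (x * u + y * w) = d * 1" using xy uw by (simp add: algebra_simps)
  then have "x * u + y * w = 1" using d(2) by (metis mult_left_cancel)
  then show ?thesis using uw by blast
qed

lemma bezout_dvd_power_imp_unit:
  fixes u w :: "'r::comm_ring_1"
  assumes "x * u + y * w = 1" and "u dvd w ^ m"
  shows "u dvd 1"
  using assms(2)
proof (induction m)
  case (Suc m)
  have "w ^ m = u * (x * w ^ m) + y * w ^ Suc m"
    using arg_cong[OF assms(1), of "\<lambda>z. z * w ^ m"] by (simp add: algebra_simps)
  then have "u dvd w ^ m" using Suc.prems by (metis dvd_add dvd_mult dvd_triv_left)
  then show ?case by (rule Suc.IH)
qed simp

text \<open>
  Up to a factor \<open>a\<close> for even index, \<open>F n\<close> is homogeneous in \<open>a^2\<close> and \<open>b\<close>, so common factors of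
  \<open>a^2\<close> and \<open>b\<close> can be pulled out. What remains is a form in \<open>u\<close> and \<open>w\<close>; the congruences identify
  its two extreme coefficients.
\<close>

lemma gen_fib_homogeneous:
  assumes "a ^ 2 = g * u" and "b = g * w"
  shows "\<exists>h. gen_fib a b (Suc (2 * m)) = g ^ m * h \<and> u dvd h - w ^ m \<and> w dvd h - u ^ m"
    and "\<exists>k. gen_fib a b (Suc (Suc (2 * m))) = a * g ^ m * k
      \<and> u dvd k - of_nat (Suc m) * w ^ m \<and> w dvd k - u ^ m"
proof -
  have "\<exists>h k. gen_fib a b (Suc (2 * m)) = g ^ m * h \<and> u dvd h - w ^ m \<and> w dvd h - u ^ m
    \<and> gen_fib a b (Suc (Suc (2 * m))) = a * g ^ m * k
    \<and> u dvd k - of_nat (Suc m) * w ^ m \<and> w dvd k - u ^ m"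
  proof (induction m)
    case 0
    show ?case by (intro exI[of _ 1]) simp
  next
    case (Suc m)
    then obtain h k where h: "gen_fib a b (Suc (2 * m)) = g ^ m * h" "u dvd h - w ^ m"
      and k: "gen_fib a b (Suc (Suc (2 * m))) = a * g ^ m * k"
        "u dvd k - of_nat (Suc m) * w ^ m" "w dvd k - u ^ m"
      by blast
    define h' k' where "h' = u * k + w * h" and "k' = h' + w * k"
    have F3: "gen_fib a b (Suc (2 * Suc m)) = g ^ Suc m * h'"
    proof -
      have "gen_fib a b (Suc (2 * Suc m))
          = a * gen_fib a b (Suc (Suc (2 * m))) + b * gen_fib a b (Suc (2 * m))"
        by simp
      also have "\<dots> = a ^ 2 * (g ^ m * k) + b * (g ^ m * h)"
        unfolding h(1) k(1) by (simp add: power2_eq_square algebra_simps)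
      finally show ?thesis by (simp add: h'_def assms algebra_simps)
    qed
    have F4: "gen_fib a b (Suc (Suc (2 * Suc m))) = a * g ^ Suc m * k'"
    proof -
      have "gen_fib a b (Suc (Suc (2 * Suc m)))
          = a * gen_fib a b (Suc (2 * Suc m)) + b * gen_fib a b (Suc (Suc (2 * m)))"
        by simp
      also have "\<dots> = a * (g ^ Suc m * h') + b * (a * g ^ m * k)"
        unfolding F3 k(1) ..
      finally show ?thesis by (simp add: k'_def assms(2) algebra_simps)
    qed
    have "h' - w ^ Suc m = u * k + w * (h - w ^ m)"
      by (simp add: h'_def algebra_simps)
    then have h'u: "u dvd h' - w ^ Suc m" using h(2) by simp
    have "h' - u ^ Suc m = w * h + u * (k - u ^ m)"
      by (simp add: h'_def algebra_simps)
    then have h'w: "w dvd h' - u ^ Suc m" using k(3) by simp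
    have "k' - of_nat (Suc (Suc m)) * w ^ Suc m
        = (h' - w ^ Suc m) + w * (k - of_nat (Suc m) * w ^ m)"
      by (simp add: k'_def algebra_simps)
    then have k'u: "u dvd k' - of_nat (Suc (Suc m)) * w ^ Suc m"
      using h'u k(2) by (metis dvd_add dvd_mult)
    have "k' - u ^ Suc m = (h' - u ^ Suc m) + w * k"
      by (simp add: k'_def algebra_simps)
    then have "w dvd k' - u ^ Suc m" using h'w by (metis dvd_add dvd_triv_left)
    then show ?case using F3 F4 h'u h'w k'u by blast
  qed
  then show "\<exists>h. gen_fib a b (Suc (2 * m)) = g ^ m * h \<and> u dvd h - w ^ m \<and> w dvd h - u ^ m"
    and "\<exists>k. gen_fib a b (Suc (Suc (2 * m))) = a * g ^ m * k
      \<and> u dvd k - of_nat (Suc m) * w ^ m \<and> w dvd k - u ^ m"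
    by blast+
qed

lemma dvd_of_nat_mult_poly_iff:
  fixes P x :: "'a::field poly"
  assumes "\<not> CHAR('a) dvd m"
  shows "P dvd of_nat m * x \<longleftrightarrow> P dvd x"
proof -
  have "(of_nat m :: 'a) \<noteq> 0" using assms by (simp add: of_nat_eq_0_iff_char_dvd)
  then show ?thesis by (simp add: of_nat_poly dvd_smult_iff)
qed

text \<open>
  For \<open>p dvd n\<close> the identity \<open>F (p * m) = F p * F m ^ p\<close> reduces the claim to a smaller index, as
  \<open>F p \<noteq> 0\<close> follows from \<open>\<Delta> \<noteq> 0\<close>. For other \<open>n\<close> both extreme coefficients of the form in
  \<open>gen_fib_homogeneous\<close> are nonzero constants. If the form vanished at the coprime pair \<open>u, w\<close>,
  each of \<open>u\<close> and \<open>w\<close> would divide a power of the other. So both would be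
  constant, and \<open>a^2 / b = u / w\<close> too.
\<close>

lemma gen_fib_nonzero:
  fixes a b :: "'a::field_prime_char poly"
  assumes "b \<noteq> 0" and "fib_discr a b \<noteq> 0" and "\<not> const_quot (a ^ 2) b" and "n > 0"
  shows "gen_fib a b n \<noteq> 0"
  using assms(4)
proof (induction n rule: less_induct)
  case (less n)
  let ?p = "CHAR('a)"
  show ?case
  proof (cases "?p dvd n")
    case True
    then obtain m where m: "n = ?p * m" by blast
    have "?p > 1" using prime_gt_1_nat[of ?p] by simp
    then have "gen_fib a b m \<noteq> 0" using less m by simp
    moreover have "gen_fib a b ?p \<noteq> 0"
      using gen_fib_char_squared[OF assms(2)] assms(2) by (metis power_eq_0_iff zero_power2)
    ultimately show ?thesis by (simp add: m gen_fib_mult_char)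
  next
    case False
    have "a \<noteq> 0"
    proof
      assume "a = 0"
      then have "Fract (a ^ 2) b = Fract [:0:] 1" using assms(1) by (simp add: eq_fract)
      then show False using assms(3) unfolding const_quot_def by blast
    qed
    then have "a ^ 2 \<noteq> 0" by simp
    then obtain g u w x y where g: "a ^ 2 = g * u" "b = g * w" and xy: "x * u + y * w = 1"
      using poly_bezout_cofactors by blast
    have "g \<noteq> 0" using g assms(1) by auto
    show ?thesis
    proof
      assume 0: "gen_fib a b n = 0"
      obtain m where "u dvd w ^ m" "w dvd u ^ m"
      proof (cases "even n")
        case even: True
        then obtain t where t: "n = 2 * t" by blast
        then obtain m where "t = Suc m" using less.prems by (cases t) auto
        then have m: "n = Suc (Suc (2 * m))" using t by simp
        have nd: "\<not> ?p dvd Suc m"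
        proof
          assume "?p dvd Suc m"
          then have "?p dvd 2 * Suc m" by (rule dvd_mult)
          then show False using False m by simp
        qed
        obtain k where k: "gen_fib a b n = a * g ^ m * k"
          "u dvd k - of_nat (Suc m) * w ^ m" "w dvd k - u ^ m"
          using gen_fib_homogeneous(2)[OF g, of m] unfolding m by blast
        have "k = 0" using k(1) 0 \<open>a \<noteq> 0\<close> \<open>g \<noteq> 0\<close> by simp
        then have "u dvd of_nat (Suc m) * w ^ m" "w dvd u ^ m"
          using k(2,3) by (simp_all only: diff_0 dvd_minus_iff)
        then show thesis using that[of m] dvd_of_nat_mult_poly_iff[OF nd] by blast
      next
        case odd: False
        then obtain m where m: "n = Suc (2 * m)" by (auto elim: oddE)
        obtain h where h: "gen_fib a b n = g ^ m * h" "u dvd h - w ^ m" "w dvd h - u ^ m"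
          using gen_fib_homogeneous(1)[OF g, of m] unfolding m by blast
        have "h = 0" using h(1) 0 \<open>g \<noteq> 0\<close> by simp
        then show thesis using that[of m] h(2,3) by simp
      qed
      moreover have "y * w + x * u = 1" using xy by (simp add: add.commute)
      ultimately have "u dvd 1" "w dvd 1" using bezout_dvd_power_imp_unit xy by blast+
      then obtain c e where ce: "u = [:c:]" "w = [:e:]" "e \<noteq> 0"
        by (auto simp: is_unit_poly_iff dvd_field_iff)
      then have "Fract (a ^ 2) b = Fract [:c / e:] 1"
        using assms(1) g by (simp add: eq_fract)
      then show False using assms(3) unfolding const_quot_def by blast
    qed
  qed
qed

section \<open>The rank of a prime\<close>

lemma not_dvd_gen_fib_Suc:
  fixes a b P :: "'a::idom poly"
  assumes "prime_elem P" and "\<not> P dvd b" and "P dvd gen_fib a b n"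
  shows "\<not> P dvd gen_fib a b (Suc n)"
proof
  assume "P dvd gen_fib a b (Suc n)"
  then have "P dvd gen_fib a b (Suc n) * gen_fib a b (n + 1)
      - gen_fib a b n * gen_fib a b (Suc (n + 1))"
    using assms(3) by (intro dvd_diff dvd_mult2)
  then have "P dvd (- b) ^ n" unfolding gen_fib_docagne by simp
  then show False using assms(1,2) prime_elem_dvd_power by fastforce
qed

lemma gen_fib_dvd_add_iff:
  fixes a b P :: "'a::idom poly"
  assumes "prime_elem P" and "\<not> P dvd b" and "P dvd gen_fib a b m"
  shows "P dvd gen_fib a b (m + n) \<longleftrightarrow> P dvd gen_fib a b n"
proof -
  have "gen_fib a b (m + n) = gen_fib a b (Suc m) * gen_fib a b n
      + gen_fib a b m * (gen_fib a b (Suc n) - a * gen_fib a b n)"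
    by (simp add: gen_fib_add algebra_simps)
  then have "P dvd gen_fib a b (m + n) \<longleftrightarrow> P dvd gen_fib a b (Suc m) * gen_fib a b n"
    using assms(3) by (simp add: dvd_add_left_iff)
  then show ?thesis
    using not_dvd_gen_fib_Suc[OF assms] assms(1) by (simp add: prime_elem_dvd_mult_iff)
qed

lemma finite_poly_degree_less:
  "finite {f :: 'a::{finite,zero} poly. degree f < d}"
proof -
  have "{f :: 'a poly. degree f < d} \<subseteq> Poly ` {xs. set xs \<subseteq> UNIV \<and> length xs \<le> d}"
  proof
    fix f :: "'a poly"
    assume "f \<in> {f. degree f < d}"
    then have "length (coeffs f) \<le> d" by (cases "f = 0") (simp_all add: length_coeffs_degree)
    then show "f \<in> Poly ` {xs. set xs \<subseteq> UNIV \<and> length xs \<le> d}"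
      by (intro image_eqI[of _ _ "coeffs f"]) simp_all
  qed
  then show ?thesis
    by (rule finite_subset) (intro finite_imageI finite_lists_length_le finite)
qed

text \<open>
  By the pigeonhole principle some pair of consecutive residues modulo \<open>P\<close> occurs at two indices
  \<open>i < j\<close>; then \<open>gen_fib_docagne\<close> gives \<open>P dvd b ^ i * F (j - i)\<close>.
\<close>

lemma gen_fib_prime_dvd_exists:
  fixes a b P :: "'a::finite_field poly"
  assumes "prime_elem P" and "\<not> P dvd b" and "degree P > 0"
  shows "\<exists>n>0. P dvd gen_fib a b n"
proof -
  let ?F = "gen_fib a b"
  define R where "R = {f :: 'a poly. degree f < degree P}"
  define f where "f i = (?F i mod P, ?F (Suc i) mod P)" for i
  have "P \<noteq> 0" using assms(3) by auto
  have "degree (h mod P) < degree P" for h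
    using degree_mod_less[OF \<open>P \<noteq> 0\<close>, of h] assms(3) by auto
  then have "range f \<subseteq> R \<times> R" by (auto simp: f_def R_def)
  moreover have "finite (R \<times> R)"
    unfolding R_def by (intro finite_cartesian_product finite_poly_degree_less)
  ultimately have "finite (range f)" by (rule finite_subset)
  then have "\<not> inj f" using finite_imageD[of f UNIV] by auto
  then obtain i j where ij: "i < j" "f i = f j"
    unfolding inj_def by (metis linorder_neqE_nat)
  define k where "k = j - i"
  have k: "j = i + k" "k > 0" using ij(1) by (simp_all add: k_def)
  have "P dvd ?F (i + k) - ?F i" "P dvd ?F (Suc (i + k)) - ?F (Suc i)"
    using ij(2) by (simp_all add: f_def k(1) mod_eq_dvd_iff[symmetric])
  then have "P dvd ?F (Suc i) * (?F (i + k) - ?F i) - ?F i * (?F (Suc (i + k)) - ?F (Suc i))"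
    by (rule dvd_diff[OF dvd_mult dvd_mult])
  also have "\<dots> = (- b) ^ i * ?F k"
    using gen_fib_docagne[of a b i k] by (simp add: algebra_simps)
  finally have "P dvd ?F k"
    using assms(1,2) prime_elem_dvd_power[OF assms(1), of "- b" i]
    by (auto simp: prime_elem_dvd_mult_iff)
  then show ?thesis using k(2) by blast
qed

lemma fib_rank_prime:
  fixes a b P :: "'a::finite_field poly"
  assumes "prime_elem P" and "\<not> P dvd b" and "degree P > 0"
  shows "fib_rank a b P > 0" and "P dvd gen_fib a b n \<longleftrightarrow> fib_rank a b P dvd n"
proof -
  define r where "r = fib_rank a b P"
  have r: "0 < r \<and> P dvd gen_fib a b r"
    using LeastI_ex[OF gen_fib_prime_dvd_exists[OF assms, of a]] unfolding r_def fib_rank_def .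
  have least: "r \<le> k" if "0 < k" "P dvd gen_fib a b k" for k
    unfolding r_def fib_rank_def using that by (intro Least_le conjI)
  have mult: "P dvd gen_fib a b (r * k)" for k
    by (induction k) (simp_all add: gen_fib_dvd_add_iff[OF assms(1,2)] r)
  have "P dvd gen_fib a b n \<longleftrightarrow> P dvd gen_fib a b (n mod r)"
    using gen_fib_dvd_add_iff[OF assms(1,2) mult, of "n div r" "n mod r"] by simp
  also have "\<dots> \<longleftrightarrow> n mod r = 0"
  proof
    assume "P dvd gen_fib a b (n mod r)"
    moreover have "n mod r < r" using r by simp
    ultimately show "n mod r = 0" using least[of "n mod r"] by linarith
  qed simp
  finally show "P dvd gen_fib a b n \<longleftrightarrow> r dvd n" by (simp add: mod_eq_0_iff_dvd)
  show "r > 0" using r by blast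
qed

section \<open>Exact powers along the multiples of the rank\<close>

lemma exact_power_gen_fib_mult:
  fixes a b P :: "'a::field poly"
  assumes "prime_elem P" and "\<not> P dvd b" and "exact_power P s (gen_fib a b n)" and "s > 0"
    and "\<not> CHAR('a) dvd m"
  shows "exact_power P s (gen_fib a b (m * n))"
proof -
  let ?y = "of_nat m * gen_fib a b (Suc n) ^ (m - 1)"
  obtain z where "gen_fib a b (m * n) - ?y * gen_fib a b n = gen_fib a b n ^ 2 * z"
    using gen_fib_mult_mod[of a b n m] by (rule dvdE)
  then have "gen_fib a b (m * n) = gen_fib a b n ^ 2 * z + ?y * gen_fib a b n"
    by (simp only: diff_eq_eq)
  then have eq: "gen_fib a b (m * n) = gen_fib a b n * (?y + gen_fib a b n * z)"
    by (simp only: power2_eq_square distrib_left mult_ac add_ac)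
  have "P \<noteq> 0" using assms(1) by auto
  then have P: "P dvd gen_fib a b n"
    using exact_power_dvd_iff[OF _ assms(3), of 1] assms(4) by simp
  then have "\<not> P dvd gen_fib a b (Suc n) ^ (m - 1)"
    using not_dvd_gen_fib_Suc[OF assms(1,2)] prime_elem_dvd_power[OF assms(1)] by blast
  then have "\<not> P dvd ?y" using dvd_of_nat_mult_poly_iff[OF assms(5)] by blast
  then have "\<not> P dvd ?y + gen_fib a b n * z" using P by (simp add: dvd_add_left_iff)
  then have "exact_power P 0 (?y + gen_fib a b n * z)"
    by (simp only: exact_power_0_iff not_False_eq_True)
  then show ?thesis
    using exact_power_mult[OF assms(1,3)] unfolding eq by (metis add_0_right)
qed

text \<open>
  The recursion for \<open>s\<close> is \<open>gen_fib_mult_char\<close> read in terms of valuations, with \<open>c\<close> the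
  valuation of \<open>F p\<close>.
\<close>

lemma exact_power_gen_fib_char_power:
  fixes a b P :: "'a::field_prime_char poly" and s :: "nat \<Rightarrow> nat"
  defines "p \<equiv> CHAR('a)"
  assumes "prime_elem P" and "exact_power P c (gen_fib a b p)"
    and "exact_power P (s 0) (gen_fib a b r)" and "\<And>k. s (Suc k) = c + p * s k"
  shows "exact_power P (s k) (gen_fib a b (r * p ^ k))"
proof (induction k)
  case 0
  then show ?case using assms(4) by simp
next
  case (Suc k)
  have "gen_fib a b (r * p ^ Suc k) = gen_fib a b p * gen_fib a b (r * p ^ k) ^ p"
    using gen_fib_mult_char[of a b "r * p ^ k"] by (simp add: p_def mult_ac)
  then show ?case
    using exact_power_mult[OF assms(2,3) exact_power_power[OF assms(2) Suc, of p]] assms(5) by simp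
qed

section \<open>Rank jumps\<close>

lemma enumerate_range_strict_mono:
  fixes s :: "nat \<Rightarrow> nat"
  assumes "strict_mono s"
  shows "enumerate (range s) k = s k"
proof (induction k)
  case 0
  show ?case unfolding enumerate_0
    using assms by (intro Least_equality) (auto simp: strict_mono_less_eq)
next
  case (Suc k)
  have "infinite (range s)" using assms strict_mono_imp_inj_on range_inj_infinite by blast
  then show ?case
    using assms by (subst enumerate_Suc'') (auto simp: Suc strict_mono_less strict_mono_less_eq
        intro!: Least_equality)
qed

text \<open>
  Suppose that the valuation of every \<open>F n\<close> divisible by \<open>P\<close> is a value \<open>s k\<close> with
  \<open>r * p ^ k dvd n\<close>, and that \<open>n = r * p ^ k\<close> itself attains it. If \<open>P ^ e dvd F n\<close>, then
  \<open>e \<le> s k\<close> for such a \<open>k\<close>, so the smallest possible \<open>n\<close> is \<open>r * p ^ k\<close> with \<open>k\<close> minimal.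
\<close>

lemma rank_jumps_eqI:
  fixes a b P :: "'a::idom poly" and s :: "nat \<Rightarrow> nat"
  assumes "P \<noteq> 0" and "strict_mono s" and "s 0 > 0" and "p > 1" and "r > 0"
    and power: "\<And>k. exact_power P (s k) (gen_fib a b (r * p ^ k))"
    and all: "\<And>n. n > 0 \<Longrightarrow> P dvd gen_fib a b n \<Longrightarrow>
      \<exists>k. r * p ^ k dvd n \<and> exact_power P (s k) (gen_fib a b n)"
  shows "rank_jumps a b P = range s" and "fib_rank a b (P ^ s k) = r * p ^ k"
proof -
  define K where "K e = (LEAST k. e \<le> s k)" for e
  have K: "e \<le> s k \<longleftrightarrow> K e \<le> k" for e k
  proof
    show "K e \<le> k" if "e \<le> s k" unfolding K_def using that by (rule Least_le)
    have "e \<le> s (K e)"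
      unfolding K_def using seq_suble[OF assms(2), of e] by (rule LeastI)
    then show "e \<le> s k" if "K e \<le> k"
      using that assms(2) by (meson order.trans strict_mono_less_eq)
  qed
  have rank: "fib_rank a b (P ^ e) = r * p ^ K e" if "e > 0" for e
    unfolding fib_rank_def
  proof (rule Least_equality)
    show "0 < r * p ^ K e \<and> P ^ e dvd gen_fib a b (r * p ^ K e)"
      using assms(4,5) exact_power_dvd_iff[OF assms(1) power] K by simp
  next
    fix n assume n: "0 < n \<and> P ^ e dvd gen_fib a b n"
    then have "P dvd gen_fib a b n" using that by (meson dvd_power dvd_trans)
    then obtain k where k: "r * p ^ k dvd n" "exact_power P (s k) (gen_fib a b n)"
      using all n by blast
    then have "K e \<le> k" using n exact_power_dvd_iff[OF assms(1)] K by blast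
    then have "r * p ^ K e \<le> r * p ^ k" using assms(4) by (simp add: power_increasing)
    also have "\<dots> \<le> n" using k(1) n by (simp add: dvd_imp_le)
    finally show "r * p ^ K e \<le> n" .
  qed
  have Ks: "K (s k) = k" for k
    using K[of "s k"] assms(2) by (meson order.antisym order.refl strict_mono_less_eq)
  have pos: "s k > 0" for k using assms(2,3) by (metis gr0I less_le_trans le0 strict_mono_less_eq)
  show "fib_rank a b (P ^ s k) = r * p ^ k" using rank[OF pos] Ks by simp
  have jump: "K e \<noteq> K (e + 1) \<longleftrightarrow> e \<in> range s" for e
  proof
    assume "e \<in> range s"
    then obtain k where "e = s k" by blast
    then show "K e \<noteq> K (e + 1)" using Ks[of k] K[of "e + 1" k] by force
  next
    assume "K e \<noteq> K (e + 1)"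
    moreover have "K e \<le> K (e + 1)" using K by (metis add_leD1 order.refl)
    ultimately have "e \<le> s (K e)" "\<not> e + 1 \<le> s (K e)" using K by auto
    then have "e = s (K e)" by simp
    then show "e \<in> range s" by blast
  qed
  have "e \<in> rank_jumps a b P \<longleftrightarrow> e \<in> range s" for e
  proof (cases "e > 0")
    case True
    then have "e \<in> rank_jumps a b P \<longleftrightarrow> r * p ^ K e \<noteq> r * p ^ K (e + 1)"
      unfolding rank_jumps_def using rank[of e] rank[of "e + 1"] by simp
    also have "\<dots> \<longleftrightarrow> K e \<noteq> K (e + 1)" using assms(4,5) by (simp del: power_Suc)
    finally show ?thesis using jump by blast
  next
    case False
    then show ?thesis
      unfolding rank_jumps_def using pos by (metis (no_types, lifting) mem_Collect_eq rangeE)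
  qed
  then show "rank_jumps a b P = range s" by blast
qed

text \<open>
  Translation by 1 permutes the field, so summing all elements shows that the cardinality vanishes
  in the field.
\<close>

lemma CHAR_eq_of_CARD_prime_power:
  assumes "prime p" and "CARD('a::finite_field) = p ^ l"
  shows "CHAR('a) = p"
proof -
  have "(\<Sum>x\<in>UNIV. x + 1) = (\<Sum>x\<in>UNIV. x :: 'a)"
    by (rule sum.reindex_bij_witness[of _ "\<lambda>x. x - 1" "\<lambda>x. x + 1"]) auto
  then have "(of_nat CARD('a) :: 'a) = 0" by (simp add: sum.distrib)
  then have "CHAR('a) dvd p ^ l"
    unfolding of_nat_eq_0_iff_char_dvd assms(2) .
  then have "CHAR('a) dvd p" using prime_dvd_power[of "CHAR('a)" p l] by simp
  then show ?thesis using assms(1) by (simp add: primes_dvd_imp_eq)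
qed

theorem theorem4p4:
  fixes a b P :: "'a::finite_field poly" and p l :: nat
  assumes "prime p" and "l \<ge> 1" and "CARD('a) = p ^ l"
    and "b \<noteq> 0"
    and "irreducible P" and "coprime b P"
    and "fib_discr a b \<noteq> 0"
    and "\<not> const_quot (a ^ 2) b"
  shows "infinite (rank_jumps a b P) \<and>
    (\<forall>i\<ge>1.
      (P dvd fib_discr a b \<longrightarrow>
        real (rank_jump a b P i)
          = (real p ^ i - 1) * real (rank_jump a b P 1) / (real p - 1) \<and>
        fib_rank a b (P ^ rank_jump a b P i) = p ^ i) \<and>
      (\<not> P dvd fib_discr a b \<longrightarrow>
        rank_jump a b P i = p ^ (i - 1) * rank_jump a b P 1 \<and>
        fib_rank a b (P ^ rank_jump a b P i) = p ^ (i - 1) * fib_rank a b P))"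
proof -
  let ?F = "gen_fib a b"
  define r where "r = fib_rank a b P"
  have p: "p = CHAR('a)" using CHAR_eq_of_CARD_prime_power[OF assms(1,3)] by simp
  have p1: "p > 1" using assms(1) by (rule prime_gt_1_nat)
  have prime: "prime_elem P" using assms(5) by (rule field_poly_irreducible_imp_prime)
  then have P0: "P \<noteq> 0" and nu: "\<not> is_unit P" by (simp_all add: prime_elem_def)
  then have deg: "degree P > 0" by (simp add: is_unit_iff_degree)
  have Pb: "\<not> P dvd b" using coprime_common_divisor[OF assms(6), of P] nu by auto
  note rank = fib_rank_prime[OF prime Pb deg, of a, folded r_def]
  have nz: "?F n \<noteq> 0" if "n > 0" for n
    using gen_fib_nonzero[OF assms(4,7,8) that] .
  obtain c where c: "exact_power P c (?F p)"
    using exact_power_exists[OF deg nz[of p]] p1 by auto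
  obtain s0 where s0: "exact_power P s0 (?F r)"
    using exact_power_exists[OF deg nz[OF rank(1)]] by auto
  \<comment> \<open>The valuation of \<open>?F (r * p ^ k)\<close>, by \<open>exact_power_gen_fib_char_power\<close>; the two cases of the claim differ only
    in \<open>c\<close> and \<open>r\<close>.\<close>
  define s where "s = rec_nat s0 (\<lambda>_ t. c + p * t)"
  have s_0: "s 0 = s0" and s_Suc: "s (Suc k) = c + p * s k" for k by (simp_all add: s_def)
  have "s0 > 0" using exact_power_dvd_iff[OF P0 s0, of 1] rank(2)[of r] by simp
  have pos: "s k > 0" for k
    by (induction k) (use \<open>s0 > 0\<close> p1 in \<open>simp_all add: s_0 s_Suc\<close>)
  have "s k < s (Suc k)" for k
  proof -
    have "1 * s k < p * s k" using pos[of k] p1 by (intro mult_strict_right_mono)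
    then show ?thesis unfolding s_Suc by linarith
  qed
  then have mono: "strict_mono s" unfolding strict_mono_Suc_iff by blast
  have power: "exact_power P (s k) (?F (r * p ^ k))" for k
    by (rule exact_power_gen_fib_char_power[OF prime, where c = c, folded p])
       (use c s0 in \<open>simp_all only: s_0 s_Suc\<close>)
  have all: "\<exists>k. r * p ^ k dvd n \<and> exact_power P (s k) (?F n)"
    if n: "n > 0" "P dvd ?F n" for n
  proof -
    obtain n' where n': "n = r * n'" using rank(2) n(2) by blast
    then obtain m where m: "n' = p ^ multiplicity p n' * m" "\<not> p dvd m"
      using multiplicity_decompose'[of n' p] n(1) p1 by auto
    have "exact_power P (s (multiplicity p n')) (?F (m * (r * p ^ multiplicity p n')))"
      using exact_power_gen_fib_mult[OF prime Pb power pos, folded p] m(2) by blast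
    also have "m * (r * p ^ multiplicity p n') = n" using n' m(1) by (simp add: mult_ac)
    finally show ?thesis using n' m(1) by (metis dvd_triv_left mult.assoc)
  qed
  have jumps: "rank_jumps a b P = range s"
    and ranks: "fib_rank a b (P ^ s k) = r * p ^ k" for k
    by (rule rank_jumps_eqI[OF P0 mono pos p1 rank(1) power]; use all in blast)+
  have inf: "infinite (rank_jumps a b P)"
    unfolding jumps by (rule range_inj_infinite[OF strict_mono_imp_inj_on[OF mono]])
  \<comment> \<open>The jumps are counted from 1, the values of \<open>s\<close> from 0.\<close>
  have e: "rank_jump a b P i = s (i - 1)" for i
    unfolding rank_jump_def jumps by (rule enumerate_range_strict_mono[OF mono])
  have "?F p ^ 2 = fib_discr a b ^ (p - 1)"
    unfolding p by (rule gen_fib_char_squared[OF assms(7)])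
  then have disc: "P dvd ?F p \<longleftrightarrow> P dvd fib_discr a b"
    using prime p1 by (metis prime_elem_dvd_power_iff zero_less_diff zero_less_numeral)
  \<comment> \<open>Here \<open>c = s0\<close>, since \<open>r = p\<close>; so \<open>s k = s0 * (1 + p + \<dots> + p ^ k)\<close>.\<close>
  have A: "real (s k) = (real p ^ Suc k - 1) * real s0 / (real p - 1)" "r = p"
    if "P dvd fib_discr a b" for k
  proof -
    have "r dvd p" using that disc rank(2) by blast
    moreover have "r \<noteq> 1" using rank(2)[of 1] nu by auto
    ultimately show "r = p" using assms(1) by (meson prime_nat_iff)
    then have "c = s0"
      using exact_power_dvd_iff[OF P0 c] exact_power_dvd_iff[OF P0 s0]
      by (metis order.antisym order.refl)
    then have "real (s k) * (real p - 1) = (real p ^ Suc k - 1) * real s0"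
    proof (induction k)
      case (Suc k)
      then show ?case by (simp add: s_Suc algebra_simps)
    qed (simp add: s_0)
    then show "real (s k) = (real p ^ Suc k - 1) * real s0 / (real p - 1)"
      using p1 by (simp add: field_simps)
  qed
  have B: "s k = p ^ k * s0" if "\<not> P dvd fib_discr a b" for k
  proof -
    have "c = 0" using exact_power_dvd_iff[OF P0 c, of 1] that disc by simp
    then show ?thesis by (induction k) (simp_all add: s_0 s_Suc)
  qed
  show ?thesis
  proof (intro conjI allI impI inf)
    fix i :: nat assume "1 \<le> i" and D: "P dvd fib_discr a b"
    then obtain k where k: "i = Suc k" by (cases i) auto
    show "real (rank_jump a b P i)
        = (real p ^ i - 1) * real (rank_jump a b P 1) / (real p - 1)"
      using A(1)[OF D, of k] by (simp add: e k s_0)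
    show "fib_rank a b (P ^ rank_jump a b P i) = p ^ i"
      using A(2)[OF D] by (simp add: e k ranks)
  next
    fix i :: nat assume "1 \<le> i" and D: "\<not> P dvd fib_discr a b"
    show "rank_jump a b P i = p ^ (i - 1) * rank_jump a b P 1"
      using B[OF D] by (simp add: e s_0)
    show "fib_rank a b (P ^ rank_jump a b P i) = p ^ (i - 1) * fib_rank a b P"
      by (simp add: e ranks flip: r_def)
  qed
qed

end
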